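(* Let $L:\mathbb{R}^n\times\mathbb{R}^m\to\mathbb{R}$ be twice differentiable and $\rho$-weakly convex-weakly concave, let $\eta>0$ with $\eta>\rho$, let $\alpha>0$, and suppose $L$ is $\alpha$-interaction dominant (with respect to the proximal parameter $\eta$) in both $x$ and $y$. Let $\lambda\in(0,1]$ satisfy $$\lambda<2\,\frac{\min\{1,(\eta/\rho-1)^2\}}{\eta/\alpha+1}.$$ Then $L$ has a unique stationary point $(x^*,y^* )$, and for any starting point $(x_0,y_0)$ the damped proximal point method with parameters $\eta,\lambda$ converges linearly to $(x^*,y^* )$, with, for all $k\ge 0$, $$\left\|\begin{bmatrix} x_k-x^*\\ y_k-y^*\end{bmatrix}\right\|^2\le\left(1-\frac{2\lambda}{\eta/\alpha+1}+\frac{\lambda^2}{\min\{1,(\eta/\rho-1)^2\}}\right)^k\left\|\begin{bmatrix} x_0-x^*\\ y_0-y^*\end{bmatrix}\right\|^2 .$$ In particular, when $\rho>0$, $\eta=2\rho$ and $\lambda=\frac{1}{1+\eta/\alpha}$, $$\left\|\begin{bmatrix} x_k-x^*\\ y_k-y^*\end{bmatrix}\right\|^2\le\left(1-\frac{1}{(2\rho/\alpha+1)^2}\right)^k\left\|\begin{bmatrix} x_0-x^*\\ y_0-y^*\end{bmatrix}\right\|^2 .$$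
   Context: A twice differentiable $L:\mathbb{R}^n\times\mathbb{R}^m\to\mathbb{R}$ is $\rho$-weakly convex-weakly concave ($\rho\in\mathbb{R}$) if $\nabla^2_{xx}L(z)\succeq-\rho I$ and $-\nabla^2_{yy}L(z)\succeq-\rho I$ for all $z=(x,y)$. A stationary point is a point $z$ with $\nabla L(z)=0$. For $\eta>\rho$, $L$ is $\alpha$-interaction dominant in $x$ if for all $z$ $$\nabla^2_{xx}L(z)+\nabla^2_{xy}L(z)(\eta I-\nabla^2_{yy}L(z))^{-1}\nabla^2_{yx}L(z)\succeq\alpha I,$$ and $\alpha$-interaction dominant in $y$ if for all $z$ $$-\nabla^2_{yy}L(z)+\nabla^2_{yx}L(z)(\eta I+\nabla^2_{xx}L(z))^{-1}\nabla^2_{xy}L(z)\succeq\alpha I.$$ The proximal operator is $\mathrm{prox}_\eta(x,y)=\arg\min_{u\in\mathbb{R}^n}\max_{v\in\mathbb{R}^m}L(u,v)+\frac{\eta}{2}\|u-x\|^2-\frac{\eta}{2}\|v-y\|^2$, meaning the unique minimax (saddle) point $(u,v)$ of this strongly convex-strongly concave problem. The damped proximal point method with damping $\lambda\in(0,1]$ is $(x_{k+1},y_{k+1})=(1-\lambda)(x_k,y_k)+\lambda\,\mathrm{prox}_\eta(x_k,y_k)$. Convention: if $\rho=0$, then $\min\{1,(\eta/\rho-1)^2\}$ is read as $1$. *)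

theory Defs
  imports "HOL-Analysis.Analysis"
begin

definition grad :: "('a::real_inner \<Rightarrow> real) \<Rightarrow> 'a \<Rightarrow> 'a" where
  "grad f z = (THE g. GDERIV f z :> g)"

definition twice_differentiable :: "('a::real_inner \<Rightarrow> real) \<Rightarrow> bool" where
  "twice_differentiable f \<longleftrightarrow>
     (\<forall>z. f differentiable (at z)) \<and> (\<forall>z. grad f differentiable (at z))"

definition stationary_point :: "('a::real_inner \<Rightarrow> real) \<Rightarrow> 'a \<Rightarrow> bool" where
  "stationary_point f z \<longleftrightarrow> grad f z = 0"

text \<open>
  The blocks of the Hessian. The inner product of the product type is the sum of the inner
  products of the components, so the components of the gradient are the partial gradients.
  In \<open>hess_xy\<close> the rows are indexed by the coordinates of \<open>x\<close>, the columns by those of \<open>y\<close>.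
\<close>

definition hess_xx :: "((real^'n) \<times> (real^'m) \<Rightarrow> real) \<Rightarrow> (real^'n) \<times> (real^'m) \<Rightarrow> real^'n^'n" where
  "hess_xx L z = matrix (\<lambda>h. fst (frechet_derivative (grad L) (at z) (h, 0)))"

definition hess_xy :: "((real^'n) \<times> (real^'m) \<Rightarrow> real) \<Rightarrow> (real^'n) \<times> (real^'m) \<Rightarrow> real^'m^'n" where
  "hess_xy L z = matrix (\<lambda>k. fst (frechet_derivative (grad L) (at z) (0, k)))"

definition hess_yx :: "((real^'n) \<times> (real^'m) \<Rightarrow> real) \<Rightarrow> (real^'n) \<times> (real^'m) \<Rightarrow> real^'n^'m" where
  "hess_yx L z = matrix (\<lambda>h. snd (frechet_derivative (grad L) (at z) (h, 0)))"

definition hess_yy :: "((real^'n) \<times> (real^'m) \<Rightarrow> real) \<Rightarrow> (real^'n) \<times> (real^'m) \<Rightarrow> real^'m^'m" where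
  "hess_yy L z = matrix (\<lambda>k. snd (frechet_derivative (grad L) (at z) (0, k)))"

text \<open>
  The Loewner order. Symmetry of \<open>A - B\<close> is not demanded: the order is only used for matrices
  built from the Hessian of a twice (Frechet) differentiable function, which is symmetric.
\<close>

definition loewner_ge :: "real^'n^'n \<Rightarrow> real^'n^'n \<Rightarrow> bool" (infix \<open>\<succeq>\<close> 50) where
  "A \<succeq> B \<longleftrightarrow> (\<forall>v. 0 \<le> v \<bullet> ((A - B) *v v))"

definition weakly_convex_concave :: "real \<Rightarrow> ((real^'n) \<times> (real^'m) \<Rightarrow> real) \<Rightarrow> bool" where
  "weakly_convex_concave \<rho> L \<longleftrightarrow>
     (\<forall>z. hess_xx L z \<succeq> mat (- \<rho>) \<and> - hess_yy L z \<succeq> mat (- \<rho>))"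

definition interaction_dominant_x ::
    "real \<Rightarrow> real \<Rightarrow> ((real^'n) \<times> (real^'m) \<Rightarrow> real) \<Rightarrow> bool" where
  "interaction_dominant_x \<eta> \<alpha> L \<longleftrightarrow>
     (\<forall>z. hess_xx L z + hess_xy L z ** matrix_inv (mat \<eta> - hess_yy L z) ** hess_yx L z \<succeq> mat \<alpha>)"

definition interaction_dominant_y ::
    "real \<Rightarrow> real \<Rightarrow> ((real^'n) \<times> (real^'m) \<Rightarrow> real) \<Rightarrow> bool" where
  "interaction_dominant_y \<eta> \<alpha> L \<longleftrightarrow>
     (\<forall>z. - hess_yy L z + hess_yx L z ** matrix_inv (mat \<eta> + hess_xx L z) ** hess_xy L z \<succeq> mat \<alpha>)"

definition saddle_point :: "('a \<times> 'b \<Rightarrow> real) \<Rightarrow> 'a \<times> 'b \<Rightarrow> bool" where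
  "saddle_point f w \<longleftrightarrow>
     (\<forall>v. f (fst w, v) \<le> f w) \<and> (\<forall>u. f w \<le> f (u, snd w))"

definition prox_objective ::
    "((real^'n) \<times> (real^'m) \<Rightarrow> real) \<Rightarrow> real \<Rightarrow> (real^'n) \<times> (real^'m) \<Rightarrow> (real^'n) \<times> (real^'m) \<Rightarrow> real" where
  "prox_objective L \<eta> z w =
     L w + \<eta> / 2 * (norm (fst w - fst z))\<^sup>2 - \<eta> / 2 * (norm (snd w - snd z))\<^sup>2"

definition prox ::
    "((real^'n) \<times> (real^'m) \<Rightarrow> real) \<Rightarrow> real \<Rightarrow> (real^'n) \<times> (real^'m) \<Rightarrow> (real^'n) \<times> (real^'m)" where
  "prox L \<eta> z = (THE w. saddle_point (prox_objective L \<eta> z) w)"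

primrec damped_ppm ::
    "((real^'n) \<times> (real^'m) \<Rightarrow> real) \<Rightarrow> real \<Rightarrow> real \<Rightarrow> (real^'n) \<times> (real^'m) \<Rightarrow> nat \<Rightarrow> (real^'n) \<times> (real^'m)" where
  "damped_ppm L \<eta> \<theta> z0 0 = z0"
| "damped_ppm L \<eta> \<theta> z0 (Suc k) =
     (1 - \<theta>) *\<^sub>R damped_ppm L \<eta> \<theta> z0 k + \<theta> *\<^sub>R prox L \<eta> (damped_ppm L \<eta> \<theta> z0 k)"

definition min_factor :: "real \<Rightarrow> real \<Rightarrow> real" where
  "min_factor \<rho> \<eta> = (if \<rho> = 0 then 1 else min 1 ((\<eta> / \<rho> - 1)\<^sup>2))"

text \<open>Linear convergence in the usual (Q-linear) sense; it implies convergence.\<close>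

definition converges_linearly :: "(nat \<Rightarrow> 'a::metric_space) \<Rightarrow> 'a \<Rightarrow> bool" where
  "converges_linearly X l \<longleftrightarrow>
     (\<exists>q. 0 \<le> q \<and> q < 1 \<and> (\<forall>\<^sub>F k in sequentially. dist (X (Suc k)) l \<le> q * dist (X k) l))"

end

theory Submission
  imports Defs
begin

text \<open>
  Let \<open>J (x, y) = (x, - y)\<close> and \<open>S = \<eta> I + J \<nabla>L\<close>. Weak convexity-concavity and the symmetry of the
  Hessian make \<open>S\<close> strongly monotone, hence a bijection, and \<open>prox\<^sub>\<eta> z\<close> is the solution \<open>w\<close> of
  \<open>S w = \<eta> z\<close>. So the proximal map is differentiable, with derivative \<open>\<eta> K\<^sup>-\<^sup>1\<close>, where
  \<open>K = \<eta> I + J \<nabla>\<^sup>2L\<close>. Interaction dominance bounds the Schur complements of \<open>K\<close>, i.e. the inverses of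
  the diagonal blocks of \<open>K\<^sup>-\<^sup>1\<close>, from below by \<open>\<eta> + \<alpha>\<close>, while the off-diagonal blocks of \<open>K\<^sup>-\<^sup>1\<close> are
  antisymmetric. Therefore the residual \<open>z \<mapsto> z - prox\<^sub>\<eta> z\<close> is strongly monotone with modulus
  \<open>1 / (\<eta> / \<alpha> + 1)\<close>. The strong monotonicity of \<open>S\<close> alone bounds its Lipschitz constant, and the damped
  step is the contraction \<open>z \<mapsto> z - \<theta> (z - prox\<^sub>\<eta> z)\<close>, whose fixed point is the stationary point.
\<close>

section \<open>Sign flip, gradients and symmetry of second derivatives\<close>

text \<open>This is the J of the overview. It turns a gradient into the descent-ascent field, whose
  derivative has a quadratic form free of interaction terms.\<close>

definition conj_snd :: "'a \<times> 'b::uminus \<Rightarrow> 'a \<times> 'b" where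
  "conj_snd w = (fst w, - snd w)"

lemma fst_conj_snd [simp]: "fst (conj_snd w) = fst w"
  and snd_conj_snd [simp]: "snd (conj_snd w) = - snd w"
  by (simp_all add: conj_snd_def)

lemma bounded_linear_conj_snd:
  "bounded_linear (conj_snd :: 'a::real_normed_vector \<times> 'b::real_normed_vector \<Rightarrow> 'a \<times> 'b)"
  unfolding conj_snd_def
  by (intro bounded_linear_Pair bounded_linear_fst bounded_linear_minus bounded_linear_snd)

text \<open>Since \<open>grad\<close> is a \<open>THE\<close>, existence and uniqueness both matter.
  The gradient is the Riesz representative of the derivative, obtained as its adjoint applied to
  \<open>1\<close>.\<close>

lemma GDERIV_grad:
  fixes f :: "'a::euclidean_space \<Rightarrow> real"
  assumes "f differentiable (at z)"
  shows "GDERIV f z :> grad f z"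
proof -
  obtain f' where f': "(f has_derivative f') (at z)"
    using assms unfolding differentiable_def by blast
  have lin: "linear f'" using f' by (rule has_derivative_linear)
  have "f' = (\<lambda>h. h \<bullet> adjoint f' 1)"
    using adjoint_works[OF lin, of _ 1] by auto
  with f' have g: "GDERIV f z :> adjoint f' 1"
    unfolding gderiv_def by simp
  have "g' = adjoint f' 1" if "GDERIV f z :> g'" for g'
    using has_derivative_unique[OF that[unfolded gderiv_def] g[unfolded gderiv_def]]
    by (metis vector_eq_ldot inner_commute)
  with g show ?thesis unfolding grad_def by (metis theI)
qed

text \<open>The second difference is symmetric in \<open>h\<close> and \<open>k\<close>, so its limit yields the symmetry of the Hessian
  without assuming that the second derivative is continuous.\<close>

lemma second_difference_tendsto:
  fixes f :: "'a::real_inner \<Rightarrow> real"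
  assumes f: "\<And>x. GDERIV f x :> g x"
    and g: "(g has_derivative H) (at z)"
  shows "((\<lambda>t. (f (z + t *\<^sub>R h + t *\<^sub>R k) - f (z + t *\<^sub>R h) - f (z + t *\<^sub>R k) + f z) / t\<^sup>2)
    \<longlongrightarrow> H k \<bullet> h) (at_right 0)"
proof (rule tendstoI)
  fix e :: real assume e: "0 < e"
  \<comment> \<open>\<open>C\<close> collects two remainders of size \<open>e' * (t * M)\<close>,
    with \<open>M\<close> as below, paired with \<open>h\<close>; the summands \<open>1\<close> keep
    it positive when \<open>h\<close> or \<open>k\<close> vanishes.\<close>
  define C where "C = 2 * (norm h + norm k + 1) * (norm h + 1)"
  have C: "C > 0" unfolding C_def by (intro mult_pos_pos add_nonneg_pos) auto
  define e' where "e' = e / (2 * C)"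
  have e': "e' > 0" using e C by (simp add: e'_def)
  interpret H: bounded_linear H using g by (rule has_derivative_bounded_linear)
  from g e' obtain d where d: "d > 0"
    and dd: "\<And>y. norm (y - z) < d \<Longrightarrow> norm (g y - g z - H (y - z)) \<le> e' * norm (y - z)"
    unfolding has_derivative_at_alt by blast
  define M where "M = norm h + norm k + 1"
  have M: "M > 0" unfolding M_def by (intro add_nonneg_pos) auto
  have "eventually (\<lambda>t::real. 0 < t \<and> t < d / M) (at_right 0)"
    using d M by (auto intro!: eventually_at_rightI[of 0 "d/M"])
  then show "\<forall>\<^sub>F t in at_right 0. dist ((f (z + t *\<^sub>R h + t *\<^sub>R k) - f (z + t *\<^sub>R h) - f (z + t *\<^sub>R k) + f z) / t\<^sup>2) (H k \<bullet> h) < e"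
  proof eventually_elim
    case (elim t)
    then have t: "0 < t" "t * M < d" using M by (auto simp: field_simps)
    \<comment> \<open>The mean value theorem in \<open>s\<close> leaves gradients at two points near
      \<open>z\<close>. Both are then compared with the linearization of \<open>g\<close> at
      \<open>z\<close>, the only point where \<open>g\<close> is differentiated.\<close>
    define \<phi> where "\<phi> s = f (z + t *\<^sub>R k + s *\<^sub>R h) - f (z + s *\<^sub>R h)" for s
    have der: "(\<phi> has_derivative (\<lambda>u. u * ((g (z + t *\<^sub>R k + s *\<^sub>R h) - g (z + s *\<^sub>R h)) \<bullet> h))) (at s within {0..t})" for s
    proof -
      have 1: "((\<lambda>s. f (w + s *\<^sub>R h)) has_derivative (\<lambda>u. (u *\<^sub>R h) \<bullet> g (w + s *\<^sub>R h))) (at s within {0..t})" for w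
        by (rule has_derivative_compose[OF _ f[unfolded gderiv_def]])
          (auto intro!: derivative_eq_intros)
      show ?thesis unfolding \<phi>_def
        by (rule has_derivative_eq_rhs[OF has_derivative_diff[OF 1 1]])
          (auto simp: fun_eq_iff inner_commute algebra_simps inner_diff_right inner_diff_left)
    qed
    obtain s where s: "0 < s" "s < t" and eq: "\<phi> t - \<phi> 0 = (t - 0) * ((g (z + t *\<^sub>R k + s *\<^sub>R h) - g (z + s *\<^sub>R h)) \<bullet> h)"
      using mvt_simple[OF t(1) der] by auto
    define r where "r y = g y - g z - H (y - z)" for y
    have b1: "norm (t *\<^sub>R k + s *\<^sub>R h) \<le> t * M"
    proof -
      have "norm (t *\<^sub>R k + s *\<^sub>R h) \<le> t * norm k + s * norm h"
        using norm_triangle_ineq[of "t *\<^sub>R k" "s *\<^sub>R h"] t s by simp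
      also have "s * norm h \<le> t * norm h" using s by (intro mult_right_mono) auto
      finally show ?thesis unfolding M_def using t by (simp add: algebra_simps)
    qed
    have b2: "norm (s *\<^sub>R h) \<le> t * M"
    proof -
      have "norm (s *\<^sub>R h) \<le> t * norm h" using s by (auto intro!: mult_right_mono)
      also have "\<dots> \<le> t * M" unfolding M_def using t by (intro mult_left_mono) auto
      finally show ?thesis .
    qed
    have r: "norm (r (z + v)) \<le> e' * (t * M)" if "norm v \<le> t * M" for v
    proof -
      have "norm (r (z + v)) \<le> e' * norm v" using dd[of "z + v"] that t unfolding r_def by auto
      also have "\<dots> \<le> e' * (t * M)" using that e' by (intro mult_left_mono) auto
      finally show ?thesis .
    qed
    \<comment> \<open>The contributions \<open>H (s *\<^sub>R h)\<close> of the two points cancel,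
      so the unknown intermediate \<open>s\<close> survives only in the remainders.\<close>
    have "g (z + t *\<^sub>R k + s *\<^sub>R h) - g (z + s *\<^sub>R h)
        = t *\<^sub>R H k + (r (z + (t *\<^sub>R k + s *\<^sub>R h)) - r (z + s *\<^sub>R h))"
      unfolding r_def by (simp add: H.add H.scale H.diff algebra_simps)
    note eq = eq[unfolded this]
    have "\<phi> t - \<phi> 0 = t\<^sup>2 * (H k \<bullet> h) + t * ((r (z + (t *\<^sub>R k + s *\<^sub>R h)) - r (z + s *\<^sub>R h)) \<bullet> h)"
      unfolding eq by (simp add: inner_add_left power2_eq_square distrib_left)
    moreover have "\<phi> t - \<phi> 0 = f (z + t *\<^sub>R h + t *\<^sub>R k) - f (z + t *\<^sub>R h) - f (z + t *\<^sub>R k) + f z"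
      unfolding \<phi>_def by (simp add: algebra_simps)
    ultimately have "(f (z + t *\<^sub>R h + t *\<^sub>R k) - f (z + t *\<^sub>R h) - f (z + t *\<^sub>R k) + f z) / t\<^sup>2
        = H k \<bullet> h + ((r (z + (t *\<^sub>R k + s *\<^sub>R h)) - r (z + s *\<^sub>R h)) \<bullet> h) / t"
      using t by (simp add: power2_eq_square add_divide_distrib)
    moreover have "\<bar>(r (z + (t *\<^sub>R k + s *\<^sub>R h)) - r (z + s *\<^sub>R h)) \<bullet> h\<bar> \<le> e' * C * t"
    proof -
      have "\<bar>(r (z + (t *\<^sub>R k + s *\<^sub>R h)) - r (z + s *\<^sub>R h)) \<bullet> h\<bar>
          \<le> norm (r (z + (t *\<^sub>R k + s *\<^sub>R h)) - r (z + s *\<^sub>R h)) * norm h"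
        by (rule Cauchy_Schwarz_ineq2)
      also have "\<dots> \<le> (e' * (t * M) + e' * (t * M)) * (norm h + 1)"
        using order_trans[OF norm_triangle_ineq4 add_mono[OF r[OF b1] r[OF b2]]] e' t M
        by (intro mult_mono) auto
      also have "\<dots> = e' * C * t" unfolding C_def M_def by (simp add: algebra_simps)
      finally show ?thesis .
    qed
    then have "\<bar>((r (z + (t *\<^sub>R k + s *\<^sub>R h)) - r (z + s *\<^sub>R h)) \<bullet> h) / t\<bar> \<le> e' * C"
      using t by (simp add: abs_divide pos_divide_le_eq)
    moreover have "e' * C < e" using e C by (simp add: e'_def)
    ultimately show ?case by (simp add: dist_real_def)
  qed
qed

lemma second_derivative_symmetric:
  fixes f :: "'a::real_inner \<Rightarrow> real"
  assumes "\<And>x. GDERIV f x :> g x" and "(g has_derivative H) (at z)"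
  shows "H h \<bullet> k = h \<bullet> H k"
proof -
  have "((\<lambda>t. (f (z + t *\<^sub>R h + t *\<^sub>R k) - f (z + t *\<^sub>R h) - f (z + t *\<^sub>R k) + f z) / t\<^sup>2)
      \<longlongrightarrow> H h \<bullet> k) (at_right 0)"
    using second_difference_tendsto[OF assms, of k h] by (simp add: algebra_simps)
  from tendsto_unique[OF _ this second_difference_tendsto[OF assms]]
  show ?thesis by (simp add: inner_commute)
qed

section \<open>Strongly monotone maps\<close>

text \<open>Pairing with \<open>x - y\<close> along the segment gives the scalar function
  \<open>\<phi>\<close>, to which the mean value theorem applies although \<open>f\<close> is
  vector-valued.\<close>

lemma strongly_monotone_derivative:
  fixes f :: "'a::real_inner \<Rightarrow> 'a"
  assumes f: "\<And>x. (f has_derivative f' x) (at x)"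
    and c: "\<And>x h. c * (norm h)\<^sup>2 \<le> f' x h \<bullet> h"
  shows "c * (norm (x - y))\<^sup>2 \<le> (f x - f y) \<bullet> (x - y)"
proof -
  define \<phi> where "\<phi> t = f (y + t *\<^sub>R (x - y)) \<bullet> (x - y)" for t :: real
  have "(\<phi> has_derivative (\<lambda>u. f' (y + t *\<^sub>R (x - y)) (u *\<^sub>R (x - y)) \<bullet> (x - y))) (at t within {0..1})" for t
    unfolding \<phi>_def
    by (intro has_derivative_inner_left has_derivative_compose[OF _ f]) (auto intro!: derivative_eq_intros)
  from mvt_simple[OF zero_less_one this] obtain t where
    "\<phi> 1 - \<phi> 0 = f' (y + t *\<^sub>R (x - y)) (x - y) \<bullet> (x - y)" by auto
  with c show ?thesis unfolding \<phi>_def by (simp add: inner_diff_left)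
qed

lemma strongly_monotone_norm_le:
  fixes d e :: "'a::real_inner"
  assumes "c * (norm d)\<^sup>2 \<le> e \<bullet> d"
  shows "c * norm d \<le> norm e"
proof (cases "d = 0")
  case False
  have "c * norm d * norm d \<le> norm e * norm d"
    using assms norm_cauchy_schwarz[of e d] by (simp add: power2_eq_square)
  with False show ?thesis by simp
qed simp

text \<open>By Cauchy-Schwarz, \<open>f\<close> expands distances by at least \<open>c\<close>,
  hence is injective. Its range is open by invariance of domain and closed because preimages of
  Cauchy sequences are Cauchy, so it is the whole space. This replaces a minimax theorem in the
  existence of the proximal point.\<close>

lemma strongly_monotone_bij:
  fixes f :: "'a::euclidean_space \<Rightarrow> 'a"
  assumes cont: "continuous_on UNIV f" and c: "c > 0"
    and mono: "\<And>x y. c * (norm (x - y))\<^sup>2 \<le> (f x - f y) \<bullet> (x - y)"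
  shows "bij f"
proof -
  have expand: "c * norm (x - y) \<le> norm (f x - f y)" for x y
    by (rule strongly_monotone_norm_le[OF mono])
  have inj: "inj f"
  proof (rule injI)
    fix x y assume "f x = f y"
    with expand[of x y] c show "x = y" by (simp add: mult_le_0_iff)
  qed
  have "open (range f)" by (rule invariance_of_domain[OF cont open_UNIV inj])
  moreover have "closed (range f)"
  proof -
    have "complete (range f)"
    proof (rule completeI)
      fix s assume s: "\<forall>n. s n \<in> range f" and cau: "Cauchy s"
      from s have "\<forall>n. \<exists>x. s n = f x" by blast
      then obtain u where u: "s n = f (u n)" for n by metis
      have "Cauchy u"
      proof (rule metric_CauchyI)
        fix e :: real assume "e > 0"
        then obtain N where N: "\<And>m n. m \<ge> N \<Longrightarrow> n \<ge> N \<Longrightarrow> dist (s m) (s n) < c * e"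
          using metric_CauchyD[OF cau, of "c * e"] c by auto
        have "dist (u m) (u n) < e" if "m \<ge> N" "n \<ge> N" for m n
        proof -
          have "c * dist (u m) (u n) \<le> dist (s m) (s n)" using expand by (simp add: u dist_norm)
          also have "\<dots> < c * e" by (rule N[OF that])
          finally show ?thesis using c by simp
        qed
        then show "\<exists>N. \<forall>m\<ge>N. \<forall>n\<ge>N. dist (u m) (u n) < e" by blast
      qed
      then obtain l where "u \<longlonglongrightarrow> l" by (auto simp: Cauchy_convergent_iff convergent_def)
      then have "(\<lambda>n. f (u n)) \<longlonglongrightarrow> f l"
        using continuous_on_tendsto_compose[OF cont] by auto
      then show "\<exists>l\<in>range f. s \<longlonglongrightarrow> l" by (auto simp flip: u)
    qed
    then show ?thesis by (rule complete_imp_closed)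
  qed
  ultimately have "range f = UNIV" using clopen by blast
  with inj show ?thesis by (simp add: bij_def)
qed

section \<open>Estimates for the inverse and for the residual\<close>

text \<open>
  Solving \<open>K p = (h\<^sub>1, 0)\<close> and \<open>K q = (0, h\<^sub>2)\<close> separately avoids writing down the block inverse of \<open>K\<close>:
  the premises on \<open>p\<close> and \<open>q\<close> are the bounds on the two Schur complements, and the cross terms cancel
  because \<open>J K\<close> is symmetric.
\<close>

lemma interaction_dominance_inverse_bound:
  fixes H :: "'a::euclidean_space \<times> 'b::euclidean_space \<Rightarrow> 'a \<times> 'b"
  assumes H: "linear H" and sym: "\<And>u v. H u \<bullet> v = u \<bullet> H v"
    and K_def: "\<And>u. K u = \<eta> *\<^sub>R u + conj_snd (H u)"
    and bij: "bij K" and b: "b > 0"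
    and X: "\<And>u. snd (K u) = 0 \<Longrightarrow> b * (norm (fst u))\<^sup>2 \<le> fst (K u) \<bullet> fst u"
    and Y: "\<And>u. fst (K u) = 0 \<Longrightarrow> b * (norm (snd u))\<^sup>2 \<le> snd (K u) \<bullet> snd u"
  shows "b * (K u \<bullet> u) \<le> (norm (K u))\<^sup>2"
proof -
  \<comment> \<open>A lower bound \<open>b\<close> on a Schur complement sending \<open>p\<close> to
    \<open>h\<close> becomes the upper bound \<open>1 / b\<close> on its inverse, without symmetry:
    expand the square of \<open>h - b *\<^sub>R p\<close> and apply the premise once.\<close>
  have aux: "b * (h \<bullet> p) \<le> (norm h)\<^sup>2" if "b * (norm p)\<^sup>2 \<le> h \<bullet> p" for h p :: "'c::real_inner"
  proof -
    have "0 \<le> (norm (h - b *\<^sub>R p))\<^sup>2" by simp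
    also have "\<dots> = (norm h)\<^sup>2 - 2 * (b * (h \<bullet> p)) + b * (b * (norm p)\<^sup>2)"
      unfolding power2_norm_eq_inner by (simp add: inner_diff inner_commute algebra_simps)
    also have "\<dots> \<le> (norm h)\<^sup>2 - 2 * (b * (h \<bullet> p)) + b * (h \<bullet> p)"
      using that b by simp
    finally show ?thesis by simp
  qed
  obtain p where p: "K p = (fst (K u), 0)" using bij by (metis bij_pointE)
  obtain q where q: "K q = (0, snd (K u))" using bij by (metis bij_pointE)
  have "K (p + q) = K p + K q"
    unfolding K_def using linear_add[OF H] by (auto simp: prod_eq_iff algebra_simps)
  then have "K (p + q) = K u" by (simp add: p q)
  then have u: "u = p + q" using bij by (metis bij_pointE)
  have J: "conj_snd (K p) \<bullet> q = p \<bullet> conj_snd (K q)"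
    using sym[of p q] unfolding K_def
    by (simp add: inner_prod_def algebra_simps inner_add_left inner_add_right)
  then have "fst (K u) \<bullet> fst q + snd (K u) \<bullet> snd p = 0"
    by (simp add: p q inner_prod_def inner_commute)
  then have "K u \<bullet> u = fst (K u) \<bullet> fst p + snd (K u) \<bullet> snd q"
    by (simp add: u inner_prod_def inner_add_right)
  moreover have "b * (fst (K u) \<bullet> fst p) \<le> (norm (fst (K u)))\<^sup>2"
    using X[of p] by (intro aux) (simp add: p)
  moreover have "b * (snd (K u) \<bullet> snd q) \<le> (norm (snd (K u)))\<^sup>2"
    using Y[of q] by (intro aux) (simp add: q)
  moreover have "(norm (K u))\<^sup>2 = (norm (fst (K u)))\<^sup>2 + (norm (snd (K u)))\<^sup>2"
    by (simp add: power2_norm_eq_inner inner_prod_def)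
  ultimately show ?thesis by (simp add: algebra_simps)
qed

lemma min_factor_pos: "\<eta> > 0 \<Longrightarrow> \<rho> < \<eta> \<Longrightarrow> 0 < min_factor \<rho> \<eta>"
  by (auto simp: min_factor_def)

lemma min_factor_le_1: "min_factor \<rho> \<eta> \<le> 1"
  by (simp add: min_factor_def)

text \<open>Here \<open>e\<close> is a difference of arguments, \<open>d\<close> that of their
  proximal points, \<open>e - d\<close> that of the residuals. With r = \<rho> / \<eta>, expanding
  the square leaves the term (2 r - 1) |d|^2. If it is nonpositive, the residual is nonexpansive;
  this covers negative \<rho>. Otherwise (1 - r) |d| <= |e| gives the factor (r / (1 - r))^2, the
  inverse of (\<eta> / \<rho> - 1)^2.\<close>

lemma min_factor_residual_le:
  fixes d e :: "'a::real_inner"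
  assumes \<eta>: "\<eta> > 0" "\<rho> < \<eta>"
    and mono: "(\<eta> - \<rho>) * (norm d)\<^sup>2 \<le> (\<eta> *\<^sub>R e) \<bullet> d"
  shows "min_factor \<rho> \<eta> * (norm (e - d))\<^sup>2 \<le> (norm e)\<^sup>2"
proof -
  define r where "r = \<rho> / \<eta>"
  have m: "(1 - r) * (norm d)\<^sup>2 \<le> e \<bullet> d"
    using mono \<eta> by (simp add: r_def field_simps)
  have r: "r < 1" using \<eta> by (simp add: r_def)
  have exp: "(norm (e - d))\<^sup>2 = (norm e)\<^sup>2 - 2 * (e \<bullet> d) + (norm d)\<^sup>2"
    unfolding power2_norm_eq_inner by (simp add: inner_diff inner_commute)
  with m have bd: "(norm (e - d))\<^sup>2 \<le> (norm e)\<^sup>2 + (2 * r - 1) * (norm d)\<^sup>2"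
    by (simp add: algebra_simps)
  show ?thesis
  proof (cases "2 * r \<le> 1")
    case True
    then have "(2 * r - 1) * (norm d)\<^sup>2 \<le> 0" by (simp add: mult_le_0_iff)
    with bd have "(norm (e - d))\<^sup>2 \<le> (norm e)\<^sup>2" by linarith
    moreover have "min_factor \<rho> \<eta> * (norm (e - d))\<^sup>2 \<le> 1 * (norm (e - d))\<^sup>2"
      by (intro mult_right_mono min_factor_le_1) simp
    ultimately show ?thesis by linarith
  next
    case False
    have r0: "r > 0" using False by simp
    have "\<rho> \<noteq> 0" using r0 by (auto simp: r_def)
    have "\<eta> / \<rho> = 1 / r" by (simp add: r_def)
    then have "min_factor \<rho> \<eta> \<le> ((1 - r) / r)\<^sup>2"
      using \<open>\<rho> \<noteq> 0\<close> r0 by (simp add: min_factor_def diff_divide_distrib)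
    then have "min_factor \<rho> \<eta> * (norm (e - d))\<^sup>2 \<le> ((1 - r) / r)\<^sup>2 * (norm (e - d))\<^sup>2"
      by (intro mult_right_mono) auto
    also have "\<dots> \<le> ((1 - r) / r)\<^sup>2 * ((norm e)\<^sup>2 + (2 * r - 1) * (norm d)\<^sup>2)"
      using bd by (intro mult_left_mono) auto
    also have "\<dots> = ((1 - r)\<^sup>2 * (norm e)\<^sup>2 + (2 * r - 1) * ((1 - r) * norm d)\<^sup>2) / r\<^sup>2"
      unfolding power_mult_distrib power_divide using r0 by (simp add: field_simps)
    also have "\<dots> \<le> ((1 - r)\<^sup>2 * (norm e)\<^sup>2 + (2 * r - 1) * (norm e)\<^sup>2) / r\<^sup>2"
      using strongly_monotone_norm_le[OF m] False r
      by (intro divide_right_mono add_left_mono mult_left_mono power_mono) auto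
    \<comment> \<open>This is the identity (1 - r)^2 + (2 r - 1) = r^2.\<close>
    also have "\<dots> = (norm e)\<^sup>2" using r0 by (simp add: field_simps power2_eq_square)
    finally show ?thesis .
  qed
qed

section \<open>Matrices and the Loewner order\<close>

lemma mat_matrix_vector_mult: "mat r *v v = r *\<^sub>R v" for v :: "real^'n"
  using matrix_vector_mul_lid[of v]
  by (simp add: vec_eq_iff mat_def matrix_vector_mult_def if_distrib[where f = "\<lambda>x. x * _"] cong: if_cong)

lemma loewner_ge_mat_iff: "A \<succeq> mat r \<longleftrightarrow> (\<forall>v. r * (norm v)\<^sup>2 \<le> v \<bullet> (A *v v))"
  by (simp add: loewner_ge_def matrix_vector_mult_diff_rdistrib mat_matrix_vector_mult inner_diff_right
      power2_norm_eq_inner)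

lemma matrix_uminus_vector_mult: "(- A) *v v = - (A *v v)" for A :: "real^'n^'m"
  using matrix_vector_mult_diff_rdistrib[of 0 A v] by simp

text \<open>\<open>matrix_inv\<close> is a choice that is meaningful only for invertible matrices;
  this covers the two shifted diagonal blocks inverted in interaction dominance.\<close>

lemma coercive_imp_invertible:
  fixes A :: "real^'n^'n"
  assumes "c > 0" and A: "\<And>v. c * (norm v)\<^sup>2 \<le> v \<bullet> (A *v v)"
  shows "invertible A"
proof -
  have "inj ((*v) A)"
  proof (rule injI)
    fix v w assume "A *v v = A *v w"
    then have "A *v (v - w) = 0" by (simp add: matrix_vector_mult_diff_distrib)
    with A[of "v - w"] \<open>c > 0\<close> show "v = w" by (simp add: mult_le_0_iff)
  qed
  then show ?thesis by (simp add: invertible_left_inverse matrix_left_invertible_injective)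
qed

lemma matrix_inv_vector_mult:
  fixes A :: "real^'n^'n"
  assumes "invertible A"
  shows "matrix_inv A *v (A *v v) = v"
proof -
  have "matrix_inv A ** A = mat 1"
    using assms unfolding invertible_def matrix_inv_def by (metis (mono_tags, lifting) someI_ex)
  then show ?thesis by (simp add: matrix_vector_mul_assoc)
qed

lemma norm_prod_square: "(norm u)\<^sup>2 = (norm (fst u))\<^sup>2 + (norm (snd u))\<^sup>2"
  for u :: "'x::real_inner \<times> 'y::real_inner"
  by (simp add: power2_norm_eq_inner inner_prod_def)

section \<open>The saddle operator and its derivative\<close>

locale prox_setting =
  fixes L :: "(real^'n) \<times> (real^'m) \<Rightarrow> real" and \<rho> \<eta> :: real
  assumes L_diff: "twice_differentiable L"
    and L_weak: "weakly_convex_concave \<rho> L"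
    and eta: "\<eta> > 0" "\<eta> > \<rho>"
begin

definition hess where "hess z = frechet_derivative (grad L) (at z)"

text \<open>This is the S of the overview, and \<open>saddle_op_deriv\<close> is the K. Up to the
  sign flip, \<open>saddle_op w - \<eta> *\<^sub>R z\<close> is the gradient of the proximal
  objective at \<open>w\<close>.\<close>

definition saddle_op where "saddle_op w = \<eta> *\<^sub>R w + conj_snd (grad L w)"

definition saddle_op_deriv where "saddle_op_deriv z u = \<eta> *\<^sub>R u + conj_snd (hess z u)"

lemma L_gderiv: "GDERIV L z :> grad L z"
  using L_diff by (intro GDERIV_grad) (simp add: twice_differentiable_def del: split_paired_All)

lemma hess_deriv: "(grad L has_derivative hess z) (at z)"
  using L_diff unfolding hess_def twice_differentiable_def by (metis frechet_derivative_works)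

lemma hess_linear: "linear (hess z)"
  using hess_deriv by (rule has_derivative_linear)

lemma hess_sym: "hess z u \<bullet> v = u \<bullet> hess z v"
  by (rule second_derivative_symmetric[OF L_gderiv hess_deriv])

lemma hess_split: "hess z u = hess z (fst u, 0) + hess z (0, snd u)"
  using linear_add[OF hess_linear, of z "(fst u, 0)" "(0, snd u)"] by simp

lemma hess_vector_mult:
  "hess_xx L z *v h = fst (hess z (h, 0))" "hess_yx L z *v h = snd (hess z (h, 0))"
  "hess_xy L z *v k = fst (hess z (0, k))" "hess_yy L z *v k = snd (hess z (0, k))"
proof -
  have "linear (\<lambda>h::real^'n. (h, 0::real^'m))" "linear (\<lambda>k::real^'m. (0::real^'n, k))"
    by (auto intro!: linearI simp: prod_eq_iff)
  note lins = linear_compose[OF linear_compose[OF this(1) hess_linear] linear_fst]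
    linear_compose[OF linear_compose[OF this(1) hess_linear] linear_snd]
    linear_compose[OF linear_compose[OF this(2) hess_linear] linear_fst]
    linear_compose[OF linear_compose[OF this(2) hess_linear] linear_snd]
  show "hess_xx L z *v h = fst (hess z (h, 0))" "hess_yx L z *v h = snd (hess z (h, 0))"
    "hess_xy L z *v k = fst (hess z (0, k))" "hess_yy L z *v k = snd (hess z (0, k))"
    using lins[THEN matrix_vector_mul(2), of z, THEN fun_cong]
    by (simp_all add: hess_xx_def hess_xy_def hess_yx_def hess_yy_def hess_def[symmetric] o_def)
qed

lemma hess_xx_ge: "- \<rho> * (norm h)\<^sup>2 \<le> h \<bullet> (hess_xx L z *v h)"
  and hess_yy_le: "- \<rho> * (norm k)\<^sup>2 \<le> - (k \<bullet> (hess_yy L z *v k))"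
  using L_weak unfolding weakly_convex_concave_def loewner_ge_mat_iff
  by (simp_all add: matrix_uminus_vector_mult del: split_paired_All)

text \<open>By symmetry of the Hessian the two interaction terms agree, and the flip gives them
  opposite signs. What remains are the diagonal blocks, bounded by weak convexity-concavity.\<close>

lemma saddle_op_deriv_coercive: "(\<eta> - \<rho>) * (norm u)\<^sup>2 \<le> saddle_op_deriv z u \<bullet> u"
proof -
  have "fst (hess z (0, snd u)) \<bullet> fst u = snd u \<bullet> snd (hess z (fst u, 0))"
    using hess_sym[of z "(0, snd u)" "(fst u, 0)"] by (simp add: inner_prod_def)
  then have "saddle_op_deriv z u \<bullet> u = \<eta> * (norm u)\<^sup>2 + fst u \<bullet> (hess_xx L z *v fst u)
      - snd u \<bullet> (hess_yy L z *v snd u)"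
    unfolding saddle_op_deriv_def hess_split[of z u] hess_vector_mult
    by (simp add: inner_prod_def inner_add_right inner_diff_right inner_commute power2_norm_eq_inner distrib_left)
  with hess_xx_ge[of "fst u" z] hess_yy_le[of "snd u" z] show ?thesis
    by (simp add: norm_prod_square algebra_simps)
qed

lemma saddle_op_deriv_linear: "linear (saddle_op_deriv z)"
proof -
  interpret hess: linear "hess z" by (rule hess_linear)
  show ?thesis unfolding saddle_op_deriv_def
    by (rule linearI) (auto simp: prod_eq_iff hess.add hess.scale algebra_simps)
qed

lemma saddle_op_deriv_bij: "bij (saddle_op_deriv z)"
  using saddle_op_deriv_coercive[of _ z] eta
  by (intro strongly_monotone_bij[where c = "\<eta> - \<rho>"])
    (auto simp: linear_diff[OF saddle_op_deriv_linear, symmetric] intro!: linear_continuous_on saddle_op_deriv_linear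
      simp: linear_linear)

lemma saddle_op_has_derivative: "(saddle_op has_derivative saddle_op_deriv z) (at z)"
  unfolding saddle_op_def saddle_op_deriv_def
  by (intro has_derivative_add has_derivative_scaleR_right has_derivative_ident
      bounded_linear.has_derivative[OF bounded_linear_conj_snd] hess_deriv)

lemma saddle_op_mono: "(\<eta> - \<rho>) * (norm (v - w))\<^sup>2 \<le> (saddle_op v - saddle_op w) \<bullet> (v - w)"
  using saddle_op_has_derivative saddle_op_deriv_coercive by (rule strongly_monotone_derivative)

lemma saddle_op_bij: "bij saddle_op"
proof (rule strongly_monotone_bij[OF _ _ saddle_op_mono])
  show "continuous_on UNIV saddle_op"
    by (meson saddle_op_has_derivative continuous_at_imp_continuous_on has_derivative_continuous)
qed (use eta in simp)

section \<open>The proximal map\<close>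

lemma prox_objective_gderiv:
  "GDERIV (prox_objective L \<eta> z) w :> conj_snd (saddle_op w - \<eta> *\<^sub>R z)"
proof -
  have "((\<lambda>w. L w + \<eta> / 2 * ((fst w - fst z) \<bullet> (fst w - fst z)) - \<eta> / 2 * ((snd w - snd z) \<bullet> (snd w - snd z)))
    has_derivative (\<lambda>h. h \<bullet> conj_snd (saddle_op w - \<eta> *\<^sub>R z))) (at w)"
    by (rule has_derivative_eq_rhs, (rule derivative_eq_intros L_gderiv[unfolded gderiv_def] refl)+)
      (auto simp: fun_eq_iff saddle_op_def inner_prod_def algebra_simps inner_add_right inner_diff_right
        inner_diff_left inner_commute)
  then show ?thesis
    unfolding gderiv_def prox_objective_def[abs_def] power2_norm_eq_inner .
qed

text \<open>One mean value argument serves both saddle inequalities: for \<open>d\<close> with a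
  single nonzero component, the pairing with the flipped difference equals the monotone pairing up
  to sign, plus in \<open>x\<close> and minus in \<open>y\<close>.\<close>

lemma prox_objective_line:
  assumes w: "saddle_op w = \<eta> *\<^sub>R z"
  obtains t where "0 < t" "prox_objective L \<eta> z (w + d) - prox_objective L \<eta> z w
    = conj_snd (saddle_op (w + t *\<^sub>R d) - saddle_op w) \<bullet> d"
    "(saddle_op (w + t *\<^sub>R d) - saddle_op w) \<bullet> d \<ge> 0"
proof -
  define \<phi> where "\<phi> t = prox_objective L \<eta> z (w + t *\<^sub>R d)" for t :: real
  have "(\<phi> has_derivative (\<lambda>u. (u *\<^sub>R d) \<bullet> conj_snd (saddle_op (w + t *\<^sub>R d) - \<eta> *\<^sub>R z))) (at t within {0..1})" for t
    unfolding \<phi>_def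
    by (rule has_derivative_compose[OF _ prox_objective_gderiv[unfolded gderiv_def]])
      (auto intro!: derivative_eq_intros)
  from mvt_simple[OF zero_less_one this] obtain t where t: "0 < t"
    and eq: "\<phi> 1 - \<phi> 0 = conj_snd (saddle_op (w + t *\<^sub>R d) - saddle_op w) \<bullet> d"
    by (auto simp: w inner_commute)
  have "0 \<le> (\<eta> - \<rho>) * (norm (w + t *\<^sub>R d - w))\<^sup>2" using eta by simp
  also have "\<dots> \<le> (saddle_op (w + t *\<^sub>R d) - saddle_op w) \<bullet> (w + t *\<^sub>R d - w)" by (rule saddle_op_mono)
  finally have "(saddle_op (w + t *\<^sub>R d) - saddle_op w) \<bullet> d \<ge> 0" using t by (simp add: zero_le_mult_iff)
  with t eq show ?thesis by (intro that) (auto simp: \<phi>_def)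
qed

text \<open>Existence and uniqueness of the proximal point thereby reduce to bijectivity of
  \<open>saddle_op\<close>. A solution is a saddle by monotonicity; conversely, both partial
  derivatives vanish at a saddle.\<close>

lemma saddle_point_prox_objective_iff:
  "saddle_point (prox_objective L \<eta> z) w \<longleftrightarrow> saddle_op w = \<eta> *\<^sub>R z"
proof
  assume w: "saddle_op w = \<eta> *\<^sub>R z"
  show "saddle_point (prox_objective L \<eta> z) w"
    unfolding saddle_point_def
  proof safe
    fix v
    from w obtain t where "prox_objective L \<eta> z (w + (0, v - snd w)) - prox_objective L \<eta> z w
      = conj_snd (saddle_op (w + t *\<^sub>R (0, v - snd w)) - saddle_op w) \<bullet> (0, v - snd w)"
      "(saddle_op (w + t *\<^sub>R (0, v - snd w)) - saddle_op w) \<bullet> (0, v - snd w) \<ge> 0"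
      by (rule prox_objective_line)
    moreover have "w + (0, v - snd w) = (fst w, v)" by (simp add: prod_eq_iff)
    ultimately show "prox_objective L \<eta> z (fst w, v) \<le> prox_objective L \<eta> z w"
      by (simp add: inner_prod_def inner_diff_left)
  next
    fix u
    from w obtain t where "prox_objective L \<eta> z (w + (u - fst w, 0)) - prox_objective L \<eta> z w
      = conj_snd (saddle_op (w + t *\<^sub>R (u - fst w, 0)) - saddle_op w) \<bullet> (u - fst w, 0)"
      "(saddle_op (w + t *\<^sub>R (u - fst w, 0)) - saddle_op w) \<bullet> (u - fst w, 0) \<ge> 0"
      by (rule prox_objective_line)
    moreover have "w + (u - fst w, 0) = (u, snd w)" by (simp add: prod_eq_iff)
    ultimately show "prox_objective L \<eta> z w \<le> prox_objective L \<eta> z (u, snd w)"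
      by (simp add: inner_prod_def inner_diff_left)
  qed
next
  assume sp: "saddle_point (prox_objective L \<eta> z) w"
  define g where "g = conj_snd (saddle_op w - \<eta> *\<^sub>R z)"
  have g: "(prox_objective L \<eta> z has_derivative (\<lambda>h. h \<bullet> g)) (at w)"
    using prox_objective_gderiv unfolding gderiv_def g_def .
  have "((\<lambda>u. prox_objective L \<eta> z (u, snd w)) has_derivative (\<lambda>h. (h, 0) \<bullet> g)) (at (fst w))"
    by (rule has_derivative_compose[where g = "prox_objective L \<eta> z" and f = "\<lambda>u. (u, snd w)"])
      (auto intro!: derivative_eq_intros simp: g)
  then have "(\<lambda>h. (h, 0) \<bullet> g) = (\<lambda>h. 0)"
    by (rule has_derivative_local_min) (use sp in \<open>auto simp: saddle_point_def\<close>)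
  from fun_cong[OF this, of "fst g"] have 1: "fst g = 0"
    by (simp add: inner_prod_def)
  have "((\<lambda>v. prox_objective L \<eta> z (fst w, v)) has_derivative (\<lambda>h. (0, h) \<bullet> g)) (at (snd w))"
    by (rule has_derivative_compose[where g = "prox_objective L \<eta> z" and f = "\<lambda>v. (fst w, v)"])
      (auto intro!: derivative_eq_intros simp: g)
  then have "(\<lambda>h. (0, h) \<bullet> g) = (\<lambda>h. 0)"
    by (rule has_derivative_local_max) (use sp in \<open>auto simp: saddle_point_def\<close>)
  from fun_cong[OF this, of "snd g"] have 2: "snd g = 0"
    by (simp add: inner_prod_def)
  from 1 2 show "saddle_op w = \<eta> *\<^sub>R z" by (simp add: g_def prod_eq_iff)
qed

lemma saddle_op_prox: "saddle_op (prox L \<eta> z) = \<eta> *\<^sub>R z"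
proof -
  have "\<exists>!w. saddle_point (prox_objective L \<eta> z) w"
    unfolding saddle_point_prox_objective_iff using saddle_op_bij by (metis bij_pointE)
  then have "saddle_point (prox_objective L \<eta> z) (prox L \<eta> z)"
    unfolding prox_def by (rule theI')
  then show ?thesis by (simp add: saddle_point_prox_objective_iff)
qed

lemma prox_mono:
  "(\<eta> - \<rho>) * (norm (prox L \<eta> z - prox L \<eta> z'))\<^sup>2 \<le> (\<eta> *\<^sub>R (z - z')) \<bullet> (prox L \<eta> z - prox L \<eta> z')"
  using saddle_op_mono[of "prox L \<eta> z" "prox L \<eta> z'"] by (simp add: saddle_op_prox scaleR_diff_right)

text \<open>The proximal map inverts \<open>saddle_op\<close> scaled by 1 / \<eta>. The inverse rule
  used here asks for continuity of the inverse rather than of the Hessian, and strong monotonicity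
  makes the proximal map Lipschitz.\<close>

lemma prox_deriv: "(prox L \<eta> has_derivative (\<lambda>h. inv (saddle_op_deriv (prox L \<eta> z)) (\<eta> *\<^sub>R h))) (at z)"
proof -
  let ?P = "prox L \<eta>" and ?K = "saddle_op_deriv (prox L \<eta> z)"
  have inv: "linear (inv ?K)"
    using saddle_op_deriv_linear saddle_op_deriv_bij by (metis bij_betw_def inj_linear_imp_inv_linear)
  have "continuous_on UNIV ?P"
  proof (rule lipschitz_on_continuous_on)
    show "(\<eta> / (\<eta> - \<rho>))-lipschitz_on UNIV ?P"
    proof (rule lipschitz_onI)
      fix x y
      show "dist (?P x) (?P y) \<le> \<eta> / (\<eta> - \<rho>) * dist x y"
        using strongly_monotone_norm_le[OF prox_mono[of x y]] eta
        by (simp add: dist_norm pos_le_divide_eq mult.commute)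
    qed (use eta in simp)
  qed
  then have cont: "continuous (at z) ?P"
    by (simp add: continuous_on_eq_continuous_at del: split_paired_All)
  show ?thesis
  proof (rule has_derivative_inverse_basic[where f = "\<lambda>w. (1 / \<eta>) *\<^sub>R saddle_op w" and T = UNIV])
    show "((\<lambda>w. (1 / \<eta>) *\<^sub>R saddle_op w) has_derivative (\<lambda>u. (1 / \<eta>) *\<^sub>R ?K u)) (at (?P z))"
      by (intro has_derivative_scaleR_right saddle_op_has_derivative)
    show "bounded_linear (\<lambda>h. inv ?K (\<eta> *\<^sub>R h))"
      using linear_compose[OF linear_scaleR inv] by (simp add: o_def linear_linear)
    show "(\<lambda>h. inv ?K (\<eta> *\<^sub>R h)) \<circ> (\<lambda>u. (1 / \<eta>) *\<^sub>R ?K u) = id"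
      using saddle_op_deriv_bij eta by (simp add: fun_eq_iff bij_is_inj)
  qed (use cont eta in \<open>auto simp: saddle_op_prox\<close>)
qed

lemma stationary_point_iff_prox_fixed: "stationary_point L z \<longleftrightarrow> prox L \<eta> z = z"
proof -
  have "stationary_point L z \<longleftrightarrow> saddle_op z = \<eta> *\<^sub>R z"
    by (auto simp: stationary_point_def saddle_op_def prod_eq_iff)
  also have "\<dots> \<longleftrightarrow> prox L \<eta> z = z"
    using saddle_op_prox[of z] saddle_op_bij by (metis bij_pointE)
  finally show ?thesis .
qed

section \<open>Interaction dominance and the residual\<close>

text \<open>The premise on \<open>u\<close> reads \<open>?A *v snd u = hess_yx L z *v fst u\<close>.
  Eliminating \<open>snd u\<close> turns the first row of K into \<eta> I plus the matrix in the
  definition of dominance.\<close>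

lemma interaction_x:
  assumes dom: "interaction_dominant_x \<eta> \<alpha> L" and u: "snd (saddle_op_deriv z u) = 0"
  shows "(\<eta> + \<alpha>) * (norm (fst u))\<^sup>2 \<le> fst (saddle_op_deriv z u) \<bullet> fst u"
proof -
  let ?A = "mat \<eta> - hess_yy L z"
  have "invertible ?A"
  proof (rule coercive_imp_invertible)
    show "(\<eta> - \<rho>) * (norm v)\<^sup>2 \<le> v \<bullet> (?A *v v)" for v
      using hess_yy_le[of v z]
      by (simp add: matrix_vector_mult_diff_rdistrib mat_matrix_vector_mult inner_diff_right
          power2_norm_eq_inner left_diff_distrib)
  qed (use eta in simp)
  moreover have "?A *v snd u = hess_yx L z *v fst u"
    using u hess_split[of z u]
    by (simp add: saddle_op_deriv_def hess_vector_mult matrix_vector_mult_diff_rdistrib mat_matrix_vector_mult algebra_simps)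
  ultimately have inv: "matrix_inv ?A *v (hess_yx L z *v fst u) = snd u"
    by (metis matrix_inv_vector_mult)
  have "\<alpha> * (norm (fst u))\<^sup>2
      \<le> fst u \<bullet> ((hess_xx L z + hess_xy L z ** matrix_inv ?A ** hess_yx L z) *v fst u)"
    using dom unfolding interaction_dominant_x_def loewner_ge_mat_iff by blast
  also have "\<dots> = fst u \<bullet> fst (hess z u)"
    unfolding hess_split[of z u]
    by (simp add: matrix_vector_mult_add_rdistrib matrix_vector_mul_assoc[symmetric] inv)
      (simp add: hess_vector_mult)
  finally show ?thesis
    by (simp add: saddle_op_deriv_def inner_add_left inner_commute power2_norm_eq_inner algebra_simps)
qed

lemma interaction_y:
  assumes dom: "interaction_dominant_y \<eta> \<alpha> L" and u: "fst (saddle_op_deriv z u) = 0"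
  shows "(\<eta> + \<alpha>) * (norm (snd u))\<^sup>2 \<le> snd (saddle_op_deriv z u) \<bullet> snd u"
proof -
  let ?A = "mat \<eta> + hess_xx L z"
  have "invertible ?A"
  proof (rule coercive_imp_invertible)
    show "(\<eta> - \<rho>) * (norm v)\<^sup>2 \<le> v \<bullet> (?A *v v)" for v
      using hess_xx_ge[of v z]
      by (simp add: matrix_vector_mult_add_rdistrib mat_matrix_vector_mult inner_add_right
          power2_norm_eq_inner left_diff_distrib)
  qed (use eta in simp)
  \<comment> \<open>Eliminating \<open>fst u\<close> brings a minus sign, which the flipped second
    row of K cancels; hence the plus sign in dominance in \<open>y\<close>.\<close>
  moreover have "?A *v fst u = - (hess_xy L z *v snd u)"
    using u hess_split[of z u]
    by (simp add: saddle_op_deriv_def hess_vector_mult matrix_vector_mult_add_rdistrib mat_matrix_vector_mult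
        eq_neg_iff_add_eq_0 algebra_simps)
  ultimately have "matrix_inv ?A *v (- (hess_xy L z *v snd u)) = fst u"
    by (metis matrix_inv_vector_mult)
  then have inv: "matrix_inv ?A *v (hess_xy L z *v snd u) = - fst u"
    using matrix_vector_mult_diff_distrib[of "matrix_inv ?A" 0 "hess_xy L z *v snd u"] by simp
  have neg: "hess_yx L z *v (- fst u) = - (hess_yx L z *v fst u)"
    using matrix_vector_mult_diff_distrib[of "hess_yx L z" 0 "fst u"] by simp
  have "\<alpha> * (norm (snd u))\<^sup>2
      \<le> snd u \<bullet> ((- hess_yy L z + hess_yx L z ** matrix_inv ?A ** hess_xy L z) *v snd u)"
    using dom unfolding interaction_dominant_y_def loewner_ge_mat_iff by blast
  also have "\<dots> = - (snd u \<bullet> snd (hess z u))"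
    unfolding hess_split[of z u]
    by (simp add: matrix_vector_mult_add_rdistrib matrix_vector_mult_diff_rdistrib
        matrix_vector_mul_assoc[symmetric] inv neg matrix_uminus_vector_mult)
      (simp add: hess_vector_mult inner_add_right inner_diff_right)
  finally show ?thesis
    by (simp add: saddle_op_deriv_def inner_add_left inner_commute power2_norm_eq_inner algebra_simps)
qed

text \<open>The derivative of the residual sends \<open>h\<close> to h - u with K u = \<eta> h. The
  inverse bound with b = \<eta> + \<alpha> limits the pairing of h and u to \<eta> / (\<eta> +
  \<alpha>) |h|^2, and the complement of this factor is the claimed modulus.\<close>

lemma residual_mono:
  assumes "\<alpha> > 0" "interaction_dominant_x \<eta> \<alpha> L" "interaction_dominant_y \<eta> \<alpha> L"
  shows "1 / (\<eta> / \<alpha> + 1) * (norm (z - z'))\<^sup>2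
    \<le> ((z - prox L \<eta> z) - (z' - prox L \<eta> z')) \<bullet> (z - z')"
proof (rule strongly_monotone_derivative)
  fix z h
  let ?K = "saddle_op_deriv (prox L \<eta> z)"
  show "((\<lambda>z. z - prox L \<eta> z) has_derivative (\<lambda>h. h - inv ?K (\<eta> *\<^sub>R h))) (at z)"
    by (intro has_derivative_diff has_derivative_ident prox_deriv)
  define u where "u = inv ?K (\<eta> *\<^sub>R h)"
  have Ku: "?K u = \<eta> *\<^sub>R h" unfolding u_def using saddle_op_deriv_bij by (simp add: bij_is_surj surj_f_inv_f)
  have "(\<eta> + \<alpha>) * (?K u \<bullet> u) \<le> (norm (?K u))\<^sup>2"
    using assms eta
    by (intro interaction_dominance_inverse_bound[OF hess_linear hess_sym saddle_op_deriv_def saddle_op_deriv_bij]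
        interaction_x interaction_y) auto
  then have "\<eta> * ((\<eta> + \<alpha>) * (h \<bullet> u)) \<le> \<eta> * (\<eta> * (norm h)\<^sup>2)"
    unfolding Ku by (simp add: power_mult_distrib power2_eq_square algebra_simps)
  then have "h \<bullet> u \<le> \<eta> / (\<eta> + \<alpha>) * (norm h)\<^sup>2"
    using eta \<open>\<alpha> > 0\<close> by (simp add: pos_le_divide_eq mult.commute)
  moreover have "1 / (\<eta> / \<alpha> + 1) = 1 - \<eta> / (\<eta> + \<alpha>)"
    using eta \<open>\<alpha> > 0\<close> by (simp add: field_simps)
  ultimately show "1 / (\<eta> / \<alpha> + 1) * (norm h)\<^sup>2 \<le> (h - inv ?K (\<eta> *\<^sub>R h)) \<bullet> h"
    by (simp add: u_def[symmetric] inner_diff_right inner_commute power2_norm_eq_inner left_diff_distrib)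
qed

section \<open>Contraction and linear convergence\<close>

lemma residual_lipschitz:
  "min_factor \<rho> \<eta> * (norm ((z - prox L \<eta> z) - (z' - prox L \<eta> z')))\<^sup>2 \<le> (norm (z - z'))\<^sup>2"
  using min_factor_residual_le[OF eta prox_mono[of z z']] by (simp add: algebra_simps)

text \<open>The step moves by -\<theta> times the residual. In the expanded square,
  \<open>residual_mono\<close> bounds the cross term and \<open>residual_lipschitz\<close> the
  quadratic one.\<close>

lemma damped_step_contraction:
  assumes \<alpha>: "\<alpha> > 0" "interaction_dominant_x \<eta> \<alpha> L" "interaction_dominant_y \<eta> \<alpha> L" and "\<theta> \<ge> 0"
  shows "(norm (((1 - \<theta>) *\<^sub>R z + \<theta> *\<^sub>R prox L \<eta> z) - ((1 - \<theta>) *\<^sub>R z' + \<theta> *\<^sub>R prox L \<eta> z')))\<^sup>2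
    \<le> (1 - 2 * \<theta> / (\<eta> / \<alpha> + 1) + \<theta>\<^sup>2 / min_factor \<rho> \<eta>) * (norm (z - z'))\<^sup>2"
proof -
  define e where "e = z - z'"
  define r where "r = (z - prox L \<eta> z) - (z' - prox L \<eta> z')"
  have m: "min_factor \<rho> \<eta> > 0" using eta by (rule min_factor_pos)
  have eq: "((1 - \<theta>) *\<^sub>R z + \<theta> *\<^sub>R prox L \<eta> z) - ((1 - \<theta>) *\<^sub>R z' + \<theta> *\<^sub>R prox L \<eta> z') = e - \<theta> *\<^sub>R r"
    by (simp add: e_def r_def algebra_simps)
  have "(norm (e - \<theta> *\<^sub>R r))\<^sup>2 = (norm e)\<^sup>2 - 2 * (\<theta> * (r \<bullet> e)) + \<theta>\<^sup>2 * (norm r)\<^sup>2"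
    unfolding power2_norm_eq_inner by (simp add: inner_diff inner_commute power2_eq_square algebra_simps)
  moreover have "\<theta> * (1 / (\<eta> / \<alpha> + 1) * (norm e)\<^sup>2) \<le> \<theta> * (r \<bullet> e)"
    using residual_mono[OF \<alpha>, of z z'] \<open>\<theta> \<ge> 0\<close> unfolding e_def r_def by (rule mult_left_mono)
  moreover have "(norm r)\<^sup>2 \<le> (norm e)\<^sup>2 / min_factor \<rho> \<eta>"
    using residual_lipschitz[of z z'] m by (simp add: e_def r_def field_simps)
  then have "\<theta>\<^sup>2 * (norm r)\<^sup>2 \<le> \<theta>\<^sup>2 * ((norm e)\<^sup>2 / min_factor \<rho> \<eta>)"
    by (rule mult_left_mono) simp
  moreover have "(1 - 2 * \<theta> / (\<eta> / \<alpha> + 1) + \<theta>\<^sup>2 / min_factor \<rho> \<eta>) * (norm e)\<^sup>2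
    = (norm e)\<^sup>2 - 2 * (\<theta> * (1 / (\<eta> / \<alpha> + 1) * (norm e)\<^sup>2)) + \<theta>\<^sup>2 * ((norm e)\<^sup>2 / min_factor \<rho> \<eta>)"
    by (simp add: ring_distribs)
  ultimately show ?thesis unfolding eq e_def[symmetric] by linarith
qed

end

theorem theorem3p1:
  fixes L :: "(real^'n) \<times> (real^'m) \<Rightarrow> real"
    and \<rho> \<eta> \<alpha> \<theta> :: real
  assumes "twice_differentiable L"
    and "weakly_convex_concave \<rho> L"
    and "\<eta> > 0" and "\<eta> > \<rho>"
    and "\<alpha> > 0"
    and "interaction_dominant_x \<eta> \<alpha> L"
    and "interaction_dominant_y \<eta> \<alpha> L"
    and "0 < \<theta>" and "\<theta> \<le> 1"
    and "\<theta> < 2 * (min_factor \<rho> \<eta> / (\<eta> / \<alpha> + 1))"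
  shows "\<exists>zs. stationary_point L zs \<and> (\<forall>z. stationary_point L z \<longrightarrow> z = zs) \<and>
    (\<forall>z0. converges_linearly (damped_ppm L \<eta> \<theta> z0) zs \<and>
      (\<forall>k. (norm (damped_ppm L \<eta> \<theta> z0 k - zs))\<^sup>2
        \<le> (1 - 2 * \<theta> / (\<eta> / \<alpha> + 1) + \<theta>\<^sup>2 / min_factor \<rho> \<eta>) ^ k * (norm (z0 - zs))\<^sup>2) \<and>
      (\<rho> > 0 \<and> \<eta> = 2 * \<rho> \<and> \<theta> = 1 / (1 + \<eta> / \<alpha>) \<longrightarrow>
        (\<forall>k. (norm (damped_ppm L \<eta> \<theta> z0 k - zs))\<^sup>2
          \<le> (1 - 1 / (2 * \<rho> / \<alpha> + 1)\<^sup>2) ^ k * (norm (z0 - zs))\<^sup>2)))"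
proof -
  interpret prox_setting L \<rho> \<eta> by unfold_locales fact+
  define q where "q = 1 - 2 * \<theta> / (\<eta> / \<alpha> + 1) + \<theta>\<^sup>2 / min_factor \<rho> \<eta>"
  define Q where "Q z = (1 - \<theta>) *\<^sub>R z + \<theta> *\<^sub>R prox L \<eta> z" for z
  have m: "min_factor \<rho> \<eta> > 0" using eta by (rule min_factor_pos)
  \<comment> \<open>Nonnegativity of \<open>q\<close>, needed for \<open>sqrt q\<close> and for
    iterating the bound: both denominators can be compared with 1, which gives q >= (1 -
    \<theta>)^2.\<close>
  have "2 * \<theta> / (\<eta> / \<alpha> + 1) \<le> 2 * \<theta>"
    using divide_pos_pos[OF \<open>\<eta> > 0\<close> \<open>\<alpha> > 0\<close>] \<open>0 < \<theta>\<close> by (simp add: divide_le_eq)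
  moreover have "\<theta>\<^sup>2 \<le> \<theta>\<^sup>2 / min_factor \<rho> \<eta>"
    using m min_factor_le_1[of \<rho> \<eta>] by (simp add: le_divide_eq mult_left_le)
  moreover have "0 \<le> (1 - \<theta>)\<^sup>2" by simp
  ultimately have q0: "0 \<le> q" unfolding q_def power2_diff by simp
  \<comment> \<open>The damping condition, multiplied by \<theta>, says exactly that the quadratic
    term of \<open>q\<close> is smaller than the linear one.\<close>
  have "\<theta> * (\<theta> / min_factor \<rho> \<eta>) < \<theta> * (2 / (\<eta> / \<alpha> + 1))"
    using assms(8,10) m by (intro mult_strict_left_mono) (simp_all add: field_simps)
  then have q1: "q < 1" unfolding q_def by (simp add: power2_eq_square mult.commute)
  have contr: "(norm (Q z - Q z'))\<^sup>2 \<le> q * (norm (z - z'))\<^sup>2" for z z'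
    unfolding Q_def q_def using assms(5-8) by (intro damped_step_contraction) auto
  \<comment> \<open>The unsquared factor \<open>sqrt q\<close> serves both Banach's theorem and the
    rate in \<open>converges_linearly\<close>.\<close>
  have lip: "dist (Q z) (Q z') \<le> sqrt q * dist z z'" for z z'
    unfolding dist_norm using real_sqrt_le_mono[OF contr[of z z']] by (simp add: real_sqrt_mult)
  have "\<exists>!z. Q z = z"
    using lip q0 q1 by (intro banach_fix_type[of "sqrt q"]) auto
  moreover have fixed: "Q z = z \<longleftrightarrow> stationary_point L z" for z
  proof -
    have "Q z = z \<longleftrightarrow> \<theta> *\<^sub>R (prox L \<eta> z - z) = 0" unfolding Q_def by (simp add: algebra_simps)
    then show ?thesis using \<open>0 < \<theta>\<close> by (simp add: stationary_point_iff_prox_fixed)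
  qed
  ultimately have "\<exists>!z. stationary_point L z" by simp
  then obtain zs where zs: "stationary_point L zs" "\<And>z. stationary_point L z \<Longrightarrow> z = zs"
    by (rule ex1E) blast
  have Qzs: "Q zs = zs" using zs(1) by (simp only: fixed)
  have step: "damped_ppm L \<eta> \<theta> z0 (Suc k) = Q (damped_ppm L \<eta> \<theta> z0 k)" for z0 k
    unfolding Q_def by (rule damped_ppm.simps(2))
  have rate: "(norm (damped_ppm L \<eta> \<theta> z0 k - zs))\<^sup>2 \<le> q ^ k * (norm (z0 - zs))\<^sup>2" for z0 k
  proof (induction k)
    case (Suc k)
    have "(norm (damped_ppm L \<eta> \<theta> z0 (Suc k) - zs))\<^sup>2 \<le> q * (norm (damped_ppm L \<eta> \<theta> z0 k - zs))\<^sup>2"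
      using contr[of "damped_ppm L \<eta> \<theta> z0 k" zs] by (simp only: step Qzs)
    also have "\<dots> \<le> q * (q ^ k * (norm (z0 - zs))\<^sup>2)"
      using Suc.IH q0 by (rule mult_left_mono)
    finally show ?case by simp
  qed simp
  have lin: "converges_linearly (damped_ppm L \<eta> \<theta> z0) zs" for z0
    unfolding converges_linearly_def
  proof (intro exI[of _ "sqrt q"] conjI always_eventually allI)
    show "dist (damped_ppm L \<eta> \<theta> z0 (Suc k)) zs \<le> sqrt q * dist (damped_ppm L \<eta> \<theta> z0 k) zs" for k
      using lip[of "damped_ppm L \<eta> \<theta> z0 k" zs] by (simp only: step Qzs)
  qed (use q0 q1 in auto)
  have special: "q = 1 - 1 / (2 * \<rho> / \<alpha> + 1)\<^sup>2" if "\<rho> > 0" "\<eta> = 2 * \<rho>" "\<theta> = 1 / (1 + \<eta> / \<alpha>)"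
  proof -
    \<comment> \<open>With \<eta> = 2 \<rho> the base \<eta> / \<rho> - 1 is 1, and the chosen
      \<theta> makes q = 1 - 2 \<theta>^2 + \<theta>^2.\<close>
    have "min_factor \<rho> \<eta> = 1" using that by (simp add: min_factor_def)
    moreover have "\<theta> = 1 / (\<eta> / \<alpha> + 1)" using that by (simp add: add.commute)
    ultimately show ?thesis using that(2) unfolding q_def by (simp add: power2_eq_square)
  qed
  show ?thesis
  proof (intro exI[of _ zs] conjI allI impI)
    show "stationary_point L zs" by (rule zs(1))
    show "z = zs" if "stationary_point L z" for z using that by (rule zs(2))
  qed (use lin rate special in \<open>auto simp: q_def[symmetric]\<close>)
qed

end
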